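(* There exists a constant $\eta>0$ such that for all $x,y\in E^N$, $$\phi(x,y)\le \eta\,\|x-y\|^{1-\kappa}.$$
   Context: Let $E$ be a finite-dimensional Euclidean space with $\dim E\ge 1$ and norm $\|\cdot\|_E$, let $N\ge 2$, let $m_1,\dots,m_N>0$ be masses and let $\kappa\in(0,1)$. For $x=(r_1,\dots,r_N)\in E^N$ put $\|x\|=\max_i\|r_i\|_E$ and $|x|^2=\sum_i m_i\|r_i\|_E^2$. The potential is $U_\kappa(x)=\sum_{i<j}m_im_j\|r_i-r_j\|_E^{-2\kappa}\in(0,+\infty]$ (equal to $+\infty$ if $r_i=r_j$ for some $i\ne j$). The action of an absolutely continuous curve $\gamma:[a,b]\to E^N$ is $A(\gamma)=\frac12\int_a^b|\dot\gamma(s)|^2ds+\int_a^bU_\kappa(\gamma(s))\,ds\in(0,+\infty]$. For $T>0$, $\mathcal C(x,y,T)$ is the set of absolutely continuous curves $\gamma:[0,T]\to E^N$ with $\gamma(0)=x$, $\gamma(T)=y$; $\phi(x,y,T)=\inf\{A(\gamma):\gamma\in\mathcal C(x,y,T)\}$; and the action potential is $\phi(x,y)=\inf_{T>0}\phi(x,y,T)$. *)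

theory Defs
  imports "HOL-Analysis.Analysis"
begin

text \<open>
  A configuration in $E^N$ is a vector of type \<open>'e ^ 'n\<close>: \<open>'e\<close> is the Euclidean space $E$
  (\<open>DIM('e) \<ge> 1\<close> holds in the class) and \<open>'n\<close> is a linearly ordered index type with $N$ elements,
  the order being used only to sum over pairs $i<j$.
\<close>

text \<open>Not the library norm of \<open>'e ^ 'n\<close>, which is the Euclidean product norm.\<close>

definition max_norm :: "'e::euclidean_space ^ 'n::finite \<Rightarrow> real" where
  "max_norm x = Max (range (\<lambda>i. norm (x $ i)))"

definition mass_norm_sq :: "('n::finite \<Rightarrow> real) \<Rightarrow> 'e::euclidean_space ^ 'n \<Rightarrow> real" where
  "mass_norm_sq m x = (\<Sum>i\<in>UNIV. m i * (norm (x $ i))\<^sup>2)"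

text \<open>The collision case has to be separate because \<open>0 powr a = 0\<close>.\<close>

definition potential ::
    "('n::{finite,linorder} \<Rightarrow> real) \<Rightarrow> real \<Rightarrow> 'e::euclidean_space ^ 'n::{finite,linorder} \<Rightarrow> ennreal" where
  "potential m \<kappa> x =
    (if \<exists>i j. i \<noteq> j \<and> x $ i = x $ j then \<infinity>
     else ennreal (\<Sum>(i, j)\<in>{(i, j). i < j}. m i * m j * norm (x $ i - x $ j) powr (- 2 * \<kappa>)))"

text \<open>
  Absolute continuity of a function on \<open>{a..b}\<close>; the library constant
  \<open>absolutely_continuous\<close> is about measures. Replacing the norm of \<open>'e ^ 'n\<close> by an equivalent
  one does not change the notion.
\<close>

definition absolutely_continuous_curve ::
    "real \<Rightarrow> real \<Rightarrow> (real \<Rightarrow> 'a::metric_space) \<Rightarrow> bool" where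
  "absolutely_continuous_curve a b f \<longleftrightarrow>
    (\<forall>\<epsilon>>0. \<exists>\<delta>>0. \<forall>(k::nat) (u::nat \<Rightarrow> real) v.
      (\<forall>i<k. a \<le> u i \<and> u i \<le> v i \<and> v i \<le> b) \<longrightarrow>
      disjoint_family_on (\<lambda>i. {u i<..<v i}) {..<k} \<longrightarrow>
      (\<Sum>i<k. v i - u i) < \<delta> \<longrightarrow>
      (\<Sum>i<k. dist (f (u i)) (f (v i))) < \<epsilon>)"

text \<open>
  An absolutely continuous curve is differentiable almost everywhere, so the (unspecified) value
  of \<open>vector_derivative\<close> at the remaining points does not matter.
\<close>

definition action ::
    "('n::{finite,linorder} \<Rightarrow> real) \<Rightarrow> real \<Rightarrow> real \<Rightarrow> real \<Rightarrow>
      (real \<Rightarrow> 'e::euclidean_space ^ 'n::{finite,linorder}) \<Rightarrow> ennreal" where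
  "action m \<kappa> a b \<gamma> =
    1 / 2 * (\<integral>\<^sup>+ s\<in>{a..b}. ennreal (mass_norm_sq m (vector_derivative \<gamma> (at s within {a..b}))) \<partial>lebesgue)
    + (\<integral>\<^sup>+ s\<in>{a..b}. potential m \<kappa> (\<gamma> s) \<partial>lebesgue)"

text \<open>
  Curves are total functions on \<open>real\<close>; absolute continuity, the endpoint conditions and the
  action depend only on their restriction to \<open>{0..T}\<close>.
\<close>

definition curves ::
    "'e::euclidean_space ^ 'n::finite \<Rightarrow> 'e ^ 'n \<Rightarrow> real \<Rightarrow> (real \<Rightarrow> 'e ^ 'n) set" where
  "curves x y T = {\<gamma>. absolutely_continuous_curve 0 T \<gamma> \<and> \<gamma> 0 = x \<and> \<gamma> T = y}"

definition fixed_time_action_potential ::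
    "('n::{finite,linorder} \<Rightarrow> real) \<Rightarrow> real \<Rightarrow>
      'e::euclidean_space ^ 'n::{finite,linorder} \<Rightarrow> 'e ^ 'n::{finite,linorder} \<Rightarrow> real \<Rightarrow> ennreal" where
  "fixed_time_action_potential m \<kappa> x y T = (INF \<gamma>\<in>curves x y T. action m \<kappa> 0 T \<gamma>)"

definition action_potential ::
    "('n::{finite,linorder} \<Rightarrow> real) \<Rightarrow> real \<Rightarrow>
      'e::euclidean_space ^ 'n::{finite,linorder} \<Rightarrow> 'e ^ 'n::{finite,linorder} \<Rightarrow> ennreal" where
  "action_potential m \<kappa> x y = (INF T\<in>{0<..}. fixed_time_action_potential m \<kappa> x y T)"

end

theory Submission
  imports Defs
begin

text \<open>
  Fix a unit vector \<open>e\<close>. Along the segment from \<open>x\<close> to \<open>y\<close> the order of the bodies by their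
  projection to \<open>e\<close> changes at finitely many times \<open>t \<in> B\<close>, at most \<open>N\<^sup>2\<close> of them. Pushing
  body number \<open>k\<close> in this order by \<open>k * f\<close> in the direction \<open>e\<close> makes all mutual distances at
  least \<open>f\<close>, and with \<open>f s = infdist s B powr (1 / (1 + \<kappa>))\<close> the curve is continuous although the
  order jumps, while both the kinetic energy and the potential are integrable near \<open>B\<close>.
  The duration \<open>r powr (1 + \<kappa>)\<close> for \<open>r = max_norm (x - y)\<close> balances the two integrals.
\<close>

section \<open>Integral bounds, and absolute continuity from a square-integrable derivative\<close>

text \<open>A finite set is Lebesgue null, so a pointwise bound may fail on it. This turns integrals
  computed from explicit antiderivatives into bounds on the two integrals of \<open>action\<close>,
  where the finite set contains the singular times.\<close>

lemma set_nn_integral_le_has_integral: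
  fixes f :: "real \<Rightarrow> ennreal"
  assumes "finite S"
    and f: "\<And>s. s \<in> {a..b} - S \<Longrightarrow> f s \<le> ennreal (h s)"
    and h: "\<And>s. s \<in> {a..b} \<Longrightarrow> 0 \<le> h s" "(h has_integral I) {a..b}"
  shows "(\<integral>\<^sup>+ s\<in>{a..b}. f s \<partial>lebesgue) \<le> ennreal I"
proof -
  have "S \<in> null_sets lebesgue"
    using \<open>finite S\<close> negligible_finite negligible_iff_null_sets by blast
  then have "AE s in lebesgue. s \<notin> S"
    by (rule AE_not_in)
  then have "AE s in lebesgue. f s * indicator {a..b} s \<le> ennreal (h s) * indicator {a..b} s"
    by eventually_elim (use f in \<open>auto simp: indicator_def\<close>)
  then have "(\<integral>\<^sup>+ s\<in>{a..b}. f s \<partial>lebesgue) \<le> (\<integral>\<^sup>+ s\<in>{a..b}. ennreal (h s) \<partial>lebesgue)"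
    by (rule nn_integral_mono_AE)
  also have "\<dots> = ennreal I"
    unfolding nn_integral_completion by (rule nn_integral_has_integral_lebesgue'[OF h])
  finally show ?thesis .
qed

text \<open>At each point at most one of the disjoint open intervals contributes, so the
  restrictions of \<open>h\<close> to them add up to at most \<open>h\<close>. Endpoints do not
  affect the integrals.\<close>

lemma sum_integral_disjoint_intervals_le:
  fixes h :: "real \<Rightarrow> real" and k :: nat
  assumes h: "h integrable_on {a..b}" "\<And>s. s \<in> {a..b} \<Longrightarrow> 0 \<le> h s"
    and uv: "\<And>i. i < k \<Longrightarrow> a \<le> u i \<and> u i \<le> v i \<and> v i \<le> b"
    and disj: "disjoint_family_on (\<lambda>i. {u i<..<v i}) {..<k}"
  shows "(\<Sum>i<k. integral {u i..v i} h) \<le> integral {a..b} h"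
proof -
  have "((\<lambda>s. if s \<in> {u i<..<v i} then h s else 0) has_integral integral {u i..v i} h) {a..b}"
    if "i < k" for i
  proof -
    have sub: "{u i..v i} \<subseteq> {a..b}" using uv[OF that] by auto
    then have "(h has_integral integral {u i..v i} h) (cbox (u i) (v i))"
      using integrable_subinterval_real[OF h(1) sub] by (simp add: has_integral_integral)
    from has_integral_restrict_open_subinterval[OF this, of a b] sub show ?thesis
      by simp
  qed
  then have "((\<lambda>s. \<Sum>i<k. if s \<in> {u i<..<v i} then h s else 0) has_integral
      (\<Sum>i<k. integral {u i..v i} h)) {a..b}"
    by (intro has_integral_sum) auto
  moreover have "(h has_integral integral {a..b} h) {a..b}"
    using h(1) by (rule integrable_integral)
  moreover have "(\<Sum>i<k. if s \<in> {u i<..<v i} then h s else 0) \<le> h s" if s: "s \<in> {a..b}" for s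
  proof (cases "\<exists>j<k. s \<in> {u j<..<v j}")
    case True
    then obtain j where j: "j < k" "s \<in> {u j<..<v j}" by blast
    have "s \<notin> {u i<..<v i}" if "i < k" "i \<noteq> j" for i
      using disj j that unfolding disjoint_family_on_def by blast
    then have "(\<Sum>i<k. if s \<in> {u i<..<v i} then h s else 0) = (\<Sum>i<k. if i = j then h s else 0)"
      by (intro sum.cong) (use j in auto)
    also have "\<dots> = h s"
      using j by simp
    finally show ?thesis by simp
  next
    case False
    then have "(\<Sum>i<k. if s \<in> {u i<..<v i} then h s else 0) = 0"
      by (intro sum.neutral) auto
    then show ?thesis using h(2)[OF s] by simp
  qed
  ultimately show ?thesis
    by (rule has_integral_le)
qed

text \<open>An increment of \<open>f\<close> is the integral of its derivative, hence at most a
  small multiple of the integral of \<open>h\<close> plus a large multiple of the length of the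
  interval. Over disjoint intervals the first parts sum to at most a multiple of the full integral
  of \<open>h\<close>, and the second parts are small when the total length is.\<close>

lemma absolutely_continuous_curve_of_square_integrable_derivative:
  fixes f :: "real \<Rightarrow> 'a::euclidean_space"
  assumes "finite S" and cont: "continuous_on {a..b} f"
    and deriv: "\<And>s. s \<in> {a<..<b} - S \<Longrightarrow> \<exists>d. (f has_vector_derivative d) (at s) \<and> (norm d)\<^sup>2 \<le> h s"
    and h: "h integrable_on {a..b}" "\<And>s. s \<in> {a..b} \<Longrightarrow> 0 \<le> h s"
  shows "absolutely_continuous_curve a b f"
  unfolding absolutely_continuous_curve_def
proof (intro allI impI)
  fix \<epsilon> :: real
  assume \<epsilon>: "\<epsilon> > 0"
  define J where "J = integral {a..b} h"
  have J: "J \<ge> 0" unfolding J_def using h by (intro integral_nonneg) auto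
  \<comment> \<open>The weight is chosen so that the \<open>h\<close> part stays below half of
    \<epsilon>, whatever the intervals are. The summand 1 keeps the denominator positive when
    \<open>J = 0\<close>.\<close>
  define c where "c = \<epsilon> / (2 * (J + 1))"
  have c: "c > 0" using \<epsilon> J by (simp add: c_def)
  have cJ: "c * J < \<epsilon> / 2"
  proof -
    have "\<epsilon> * J < \<epsilon> * (J + 1)" using \<epsilon> by simp
    then show ?thesis using J by (simp add: c_def field_simps)
  qed
  \<comment> \<open>Young's inequality stands in for Cauchy-Schwarz.\<close>
  have incr: "dist (f u) (f v) \<le> c * integral {u..v} h + (v - u) / (4 * c)"
    if uv: "a \<le> u" "u \<le> v" "v \<le> b" for u v
  proof -
    \<comment> \<open>A total choice of the derivative. The value 0 at the exceptional points keeps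
      \<open>(norm (g s))\<^sup>2 \<le> h s\<close> on the whole interval, because \<open>h\<close>
      is nonnegative there.\<close>
    define g where "g s = (if s \<in> {a<..<b} - S
      then SOME d. (f has_vector_derivative d) (at s) \<and> (norm d)\<^sup>2 \<le> h s else 0)" for s
    have g: "(f has_vector_derivative g s) (at s) \<and> (norm (g s))\<^sup>2 \<le> h s" if "s \<in> {a<..<b} - S" for s
      using someI_ex[OF deriv[OF that]] that by (simp add: g_def)
    have sub: "{u..v} \<subseteq> {a..b}" using uv by auto
    have g_int: "(g has_integral f v - f u) {u..v}"
      by (rule fundamental_theorem_of_calculus_interior_strong[OF \<open>finite S\<close> \<open>u \<le> v\<close>])
        (use g uv continuous_on_subset[OF cont sub] in auto)
    have g_le: "norm (g s) \<le> c * h s + 1 / (4 * c)" if "s \<in> {u..v}" for s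
    proof -
      have "(norm (g s))\<^sup>2 \<le> h s"
        using g[of s] h(2)[of s] sub that by (cases "s \<in> {a<..<b} - S") (auto simp: g_def)
      then have "c * (norm (g s))\<^sup>2 \<le> c * h s" using c by simp
      moreover have "norm (g s) \<le> c * (norm (g s))\<^sup>2 + 1 / (4 * c)"
      proof -
        have "0 \<le> (2 * c * norm (g s) - 1)\<^sup>2 / (4 * c)" using c by simp
        also have "\<dots> = c * (norm (g s))\<^sup>2 + 1 / (4 * c) - norm (g s)"
          using c by (simp add: field_simps power2_eq_square)
        finally show ?thesis by simp
      qed
      ultimately show ?thesis by simp
    qed
    have h_uv: "h integrable_on {u..v}"
      using integrable_subinterval_real[OF h(1) sub] .
    have bound_int: "((\<lambda>s. c * h s + 1 / (4 * c)) has_integral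
        c * integral {u..v} h + (v - u) / (4 * c)) {u..v}"
    proof -
      have "((\<lambda>s. 1 / (4 * c)) has_integral (v - u) *\<^sub>R (1 / (4 * c))) {u..v}"
        using has_integral_const_real[of "1 / (4 * c)" u v] uv by simp
      from has_integral_add[OF has_integral_mult_right[OF integrable_integral[OF h_uv]] this]
      show ?thesis by simp
    qed
    have "norm (integral {u..v} g) \<le> integral {u..v} (\<lambda>s. c * h s + 1 / (4 * c))"
      using g_int bound_int g_le
      by (intro Henstock_Kurzweil_Integration.integral_norm_bound_integral)
        (auto simp: has_integral_integrable)
    then show ?thesis
      using integral_unique[OF g_int] integral_unique[OF bound_int]
      by (simp add: dist_norm norm_minus_commute)
  qed
  show "\<exists>\<delta>>0. \<forall>(k::nat) u v. (\<forall>i<k. a \<le> u i \<and> u i \<le> v i \<and> v i \<le> b) \<longrightarrow>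
      disjoint_family_on (\<lambda>i. {u i<..<v i}) {..<k} \<longrightarrow> (\<Sum>i<k. v i - u i) < \<delta> \<longrightarrow>
      (\<Sum>i<k. dist (f (u i)) (f (v i))) < \<epsilon>"
  \<comment> \<open>With this threshold the length part, total length over \<open>4 * c\<close>, is
    below the other half of \<epsilon>.\<close>
  proof (intro exI[of _ "2 * c * \<epsilon>"] conjI allI impI)
    show "2 * c * \<epsilon> > 0" using c \<epsilon> by simp
    fix k :: nat and u v :: "nat \<Rightarrow> real"
    assume uv: "\<forall>i<k. a \<le> u i \<and> u i \<le> v i \<and> v i \<le> b"
      and disj: "disjoint_family_on (\<lambda>i. {u i<..<v i}) {..<k}"
      and small: "(\<Sum>i<k. v i - u i) < 2 * c * \<epsilon>"
    have "(\<Sum>i<k. dist (f (u i)) (f (v i))) \<le>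
        (\<Sum>i<k. c * integral {u i..v i} h + (v i - u i) / (4 * c))"
      by (intro sum_mono incr) (use uv in auto)
    also have "\<dots> = c * (\<Sum>i<k. integral {u i..v i} h) + (\<Sum>i<k. v i - u i) / (4 * c)"
      by (simp add: sum.distrib sum_distrib_left sum_divide_distrib)
    also have "\<dots> < \<epsilon> / 2 + \<epsilon> / 2"
    proof (rule add_strict_mono)
      have "(\<Sum>i<k. integral {u i..v i} h) \<le> J"
        unfolding J_def by (rule sum_integral_disjoint_intervals_le) (use h uv disj in auto)
      then have "c * (\<Sum>i<k. integral {u i..v i} h) \<le> c * J" using c by simp
      with cJ show "c * (\<Sum>i<k. integral {u i..v i} h) < \<epsilon> / 2" by simp
      show "(\<Sum>i<k. v i - u i) / (4 * c) < \<epsilon> / 2"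
        using small c by (simp add: field_simps)
    qed
    finally show "(\<Sum>i<k. dist (f (u i)) (f (v i))) < \<epsilon>" by simp
  qed
qed

section \<open>Powers of the distance to a finite set of times\<close>

text \<open>The interval is split at the singularity \<open>t\<close>. On each side the
  antiderivative is a power with exponent \<open>1 - \<beta> > 0\<close>, hence continuous up to
  \<open>t\<close>, and the fundamental theorem asks for the derivative in the open interval
  only.\<close>

lemma has_integral_abs_diff_powr:
  fixes \<beta> t T :: real
  assumes "\<beta> < 1" and t: "t \<in> {0..T}"
  shows "((\<lambda>s. \<bar>s - t\<bar> powr (- \<beta>)) has_integral
    (t powr (1 - \<beta>) + (T - t) powr (1 - \<beta>)) / (1 - \<beta>)) {0..T}"
proof -
  have "((\<lambda>s. \<bar>s - t\<bar> powr (- \<beta>)) has_integral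
      - ((t - t) powr (1 - \<beta>) / (1 - \<beta>)) - (- ((t - 0) powr (1 - \<beta>) / (1 - \<beta>)))) {0..t}"
  proof (rule fundamental_theorem_of_calculus_interior)
    show "continuous_on {0..t} (\<lambda>s. - ((t - s) powr (1 - \<beta>) / (1 - \<beta>)))"
      using assms by (intro continuous_intros continuous_on_powr') auto
    fix s assume s: "s \<in> {0<..<t}"
    show "((\<lambda>s. - ((t - s) powr (1 - \<beta>) / (1 - \<beta>))) has_vector_derivative \<bar>s - t\<bar> powr (- \<beta>)) (at s)"
      unfolding has_real_derivative_iff_has_vector_derivative[symmetric]
      using assms s by (auto intro!: derivative_eq_intros)
  qed (use t in auto)
  moreover have "((\<lambda>s. \<bar>s - t\<bar> powr (- \<beta>)) has_integral
      (T - t) powr (1 - \<beta>) / (1 - \<beta>) - (t - t) powr (1 - \<beta>) / (1 - \<beta>)) {t..T}"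
  proof (rule fundamental_theorem_of_calculus_interior)
    show "continuous_on {t..T} (\<lambda>s. (s - t) powr (1 - \<beta>) / (1 - \<beta>))"
      using assms by (intro continuous_intros continuous_on_powr') auto
    fix s assume s: "s \<in> {t<..<T}"
    show "((\<lambda>s. (s - t) powr (1 - \<beta>) / (1 - \<beta>)) has_vector_derivative \<bar>s - t\<bar> powr (- \<beta>)) (at s)"
      unfolding has_real_derivative_iff_has_vector_derivative[symmetric]
      using assms s by (auto intro!: derivative_eq_intros)
  qed (use t in auto)
  ultimately show ?thesis
    using has_integral_combine[of 0 t T] t by (fastforce simp: add_divide_distrib)
qed

text \<open>Away from the midpoints of pairs from \<open>B\<close> the nearest point
  \<open>t\<close> of \<open>B\<close> is unique, and by continuity it remains nearest in a
  neighbourhood. There the distance to \<open>B\<close> is \<open>\<bar>r - t\<bar>\<close>, which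
  is smooth off \<open>t\<close>. Only the size of the derivative is recorded, since its sign
  depends on the side of \<open>t\<close>.\<close>

lemma infdist_powr_derivative:
  fixes B :: "real set"
  assumes "finite B" "B \<noteq> {}"
    and s: "s \<notin> B" "s \<notin> (\<lambda>(t, t'). (t + t') / 2) ` (B \<times> B)"
  obtains d where "((\<lambda>s. infdist s B powr a) has_real_derivative d) (at s)"
    "\<bar>d\<bar> = \<bar>a\<bar> * infdist s B powr (a - 1)"
proof -
  obtain t where t: "t \<in> B" "infdist s B = dist s t"
    using infdist_attains_inf[of B s] assms finite_imp_closed by blast
  have closest: "dist s t < dist s t'" if "t' \<in> B" "t' \<noteq> t" for t'
  proof -
    have "dist s t \<le> dist s t'" using infdist_le[OF that(1), of s] t by simp
    moreover have "dist s t \<noteq> dist s t'"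
    proof
      assume "dist s t = dist s t'"
      then have "s = (t + t') / 2" using that(2) by (auto simp: dist_real_def abs_if split: if_splits)
      then show False using s(2) t(1) that(1) by (auto simp: image_iff)
    qed
    ultimately show ?thesis by simp
  qed
  have "\<forall>\<^sub>F r in nhds s. \<forall>t'\<in>B. dist r t \<le> dist r t'"
  proof (intro eventually_ball_finite[OF \<open>finite B\<close>] ballI)
    fix t' assume t': "t' \<in> B"
    show "\<forall>\<^sub>F r in nhds s. dist r t \<le> dist r t'"
    proof (cases "t' = t")
      case False
      have "((\<lambda>r. dist r t' - dist r t) \<longlongrightarrow> dist s t' - dist s t) (nhds s)"
        by (intro tendsto_intros filterlim_ident)
      then have "\<forall>\<^sub>F r in nhds s. dist r t' - dist r t > 0"
        by (rule order_tendstoD) (use closest[OF t' False] in simp)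
      then show ?thesis by eventually_elim simp
    qed simp
  qed
  then have near: "\<forall>\<^sub>F r in nhds s. infdist r B powr a = \<bar>r - t\<bar> powr a"
  proof eventually_elim
    case (elim r)
    obtain t' where "t' \<in> B" "infdist r B = dist r t'"
      using infdist_attains_inf[of B r] assms finite_imp_closed by blast
    then have "infdist r B = dist r t"
      using elim infdist_le[OF t(1), of r] by force
    then show ?case by (simp add: dist_real_def)
  qed
  have st: "s - t \<noteq> 0" using s(1) t(1) by auto
  have "((\<lambda>r. \<bar>r - t\<bar>) has_real_derivative sgn (s - t)) (at s)"
    using DERIV_chain2[of abs "sgn (s - t)" "\<lambda>r. r - t" s 1] GDERIV_norm[OF st]
      DERIV_diff[OF DERIV_ident[of "at s"] DERIV_const[of t]] by simp
  then have "((\<lambda>r. \<bar>r - t\<bar> powr a) has_real_derivative a * \<bar>s - t\<bar> powr (a - 1) * sgn (s - t)) (at s)"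
    using st by (auto intro!: derivative_eq_intros)
  then have "((\<lambda>s. infdist s B powr a) has_real_derivative
      a * \<bar>s - t\<bar> powr (a - 1) * sgn (s - t)) (at s)"
    using DERIV_cong_ev[OF refl near refl] by simp
  then show thesis
    by (rule that) (use st t(2) in \<open>simp add: abs_mult dist_real_def abs_sgn_eq\<close>)
qed

text \<open>The distance is attained, so the left side is one of the summands. This replaces the
  distance by singularities whose integrals are explicit.\<close>

lemma infdist_powr_le_sum:
  fixes B :: "real set"
  assumes "finite B" "B \<noteq> {}"
  shows "infdist s B powr p \<le> (\<Sum>t\<in>B. \<bar>s - t\<bar> powr p)"
proof -
  obtain t where t: "t \<in> B" "infdist s B = dist s t"
    using infdist_attains_inf[of B s] assms finite_imp_closed by blast
  then have "infdist s B powr p = \<bar>s - t\<bar> powr p"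
    by (simp add: dist_real_def)
  also have "\<dots> \<le> (\<Sum>t\<in>B. \<bar>s - t\<bar> powr p)"
    using member_le_sum[OF t(1), of "\<lambda>t. \<bar>s - t\<bar> powr p"] \<open>finite B\<close> by simp
  finally show ?thesis .
qed

section \<open>Ordering the bodies and separating them\<close>

text \<open>Ties are broken by the index order, so that bodies with the same projection, colliding
  ones in particular, still receive different ranks.\<close>

definition rank :: "('n::{finite,linorder} \<Rightarrow> real) \<Rightarrow> 'n \<Rightarrow> real" where
  "rank l i = real (card {j. l j < l i \<or> l j = l i \<and> j < i})"

lemma rank_nonneg: "0 \<le> rank l i"
  by (simp add: rank_def)

lemma rank_le: "rank l (i :: 'n::{finite,linorder}) \<le> CARD('n)"
  unfolding rank_def by (simp add: card_mono)

lemma rank_less: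
  assumes "l j < l i \<or> l j = l i \<and> j < i"
  shows "rank l j + 1 \<le> rank l i"
proof -
  have "{k. l k < l j \<or> l k = l j \<and> k < j} \<subset> {k. l k < l i \<or> l k = l i \<and> k < i}"
    using assms by force
  then have "card {k. l k < l j \<or> l k = l j \<and> k < j} < card {k. l k < l i \<or> l k = l i \<and> k < i}"
    by (intro psubset_card_mono) auto
  then show ?thesis unfolding rank_def by linarith
qed

text \<open>The shift never reverses the order: the differences of \<open>l\<close> and of
  \<open>rank l\<close> do not have opposite signs, and ranks differ by at least 1.\<close>

lemma rank_separates:
  assumes "i \<noteq> j" "0 \<le> h"
  shows "h \<le> \<bar>(l i + h * rank l i) - (l j + h * rank l j)\<bar>"
proof -
  have *: "h \<le> (l i + h * rank l i) - (l j + h * rank l j)"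
    if "l j < l i \<or> l j = l i \<and> j < i" for i j
  proof -
    have "h * 1 \<le> h * (rank l i - rank l j)"
      using rank_less[OF that] assms(2) by (intro mult_left_mono) auto
    with that show ?thesis by (auto simp: algebra_simps)
  qed
  consider "l j < l i \<or> l j = l i \<and> j < i" | "l i < l j \<or> l i = l j \<and> i < j"
    using assms(1) by fastforce
  then show ?thesis
    by cases (use *[of j i] *[of i j] in auto)
qed

section \<open>Construction of the spreading curve\<close>

text \<open>The velocity bound serves the kinetic energy and the distance bound the potential. The
  bound on \<open>card B\<close> does not depend on \<open>x\<close>, \<open>y\<close> and
  \<open>T\<close>, which makes the final constant uniform.\<close>

lemma spreading_curve:
  fixes x y :: "'e::euclidean_space ^ 'n::{finite,linorder}" and a T :: real
  assumes "0 < a" "0 < T"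
  obtains \<gamma> B S where "finite B" "B \<noteq> {}" "B \<subseteq> {0..T}" "card B \<le> (CARD('n))\<^sup>2 + 2"
    "\<gamma> 0 = x" "\<gamma> T = y" "continuous_on {0..T} \<gamma>" "finite S" "B \<subseteq> S"
    "\<And>s. s \<in> {0..T} - S \<Longrightarrow> \<exists>d. (\<gamma> has_vector_derivative d) (at s) \<and>
      (\<forall>i. norm (d $ i) \<le> norm ((x - y) $ i) / T + a * CARD('n) * infdist s B powr (a - 1))"
    "\<And>s i j. s \<in> {0..T} \<Longrightarrow> i \<noteq> j \<Longrightarrow> infdist s B powr a \<le> norm (\<gamma> s $ i - \<gamma> s $ j)"
proof -
  obtain e :: 'e where e: "e \<in> Basis" using nonempty_Basis by blast
  \<comment> \<open>The projection to \<open>e\<close> of body \<open>i\<close> at time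
    \<open>s\<close> on the segment from \<open>x\<close> to \<open>y\<close>.\<close>
  define l where "l s i = x $ i \<bullet> e + s / T * ((y $ i - x $ i) \<bullet> e)" for s i
  \<comment> \<open>If the projections of bodies \<open>i\<close> and \<open>j\<close> differ by
    \<open>p\<close> at the start and by \<open>q\<close> at the end, they meet where
    \<open>p + s / T * (q - p) = 0\<close>. For \<open>p = q\<close> the division yields 0, which
    lies in \<open>B\<close> anyway.\<close>
  define crossing where
    "crossing = (\<lambda>(i, j). T * ((x $ i - x $ j) \<bullet> e) / ((x $ i - x $ j) \<bullet> e - (y $ i - y $ j) \<bullet> e))"
  \<comment> \<open>The endpoints are included so that the push vanishes there and the curve still
    joins \<open>x\<close> to \<open>y\<close>.\<close>
  define B where "B = ({0, T} \<union> range crossing) \<inter> {0..T}"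
  \<comment> \<open>At the midpoints the nearest point of \<open>B\<close> may change, and the
    distance to \<open>B\<close> may have a kink.\<close>
  define S where "S = B \<union> (\<lambda>(t, t'). (t + t') / 2) ` (B \<times> B)"
  define f where "f s = infdist s B powr a" for s
  define w :: "real \<Rightarrow> 'e ^ 'n::{finite,linorder}" where "w s = (\<chi> i. rank (l s) i *\<^sub>R e)" for s
  define \<gamma> where "\<gamma> s = x + (s / T) *\<^sub>R (y - x) + f s *\<^sub>R w s" for s
  have B: "finite B" "0 \<in> B" "T \<in> B" "B \<subseteq> {0..T}"
    using \<open>0 < T\<close> by (auto simp: B_def)
  have "card B \<le> card ({0, T} \<union> range crossing)"
    unfolding B_def by (intro card_mono) auto
  also have "\<dots> \<le> card {0, T} + card (range crossing)"
    by (rule card_Un_le)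
  also have "\<dots> \<le> 2 + CARD('n \<times> 'n)"
    by (intro add_mono card_image_le) (auto simp: card_insert_if)
  finally have card_B: "card B \<le> (CARD('n))\<^sup>2 + 2"
    by (simp add: power2_eq_square)
  have f_nonneg: "0 \<le> f s" for s by (simp add: f_def)
  have f_B: "f s = 0" if "s \<in> B" for s using that by (simp add: f_def)
  have "continuous_on UNIV f"
    unfolding f_def using \<open>0 < a\<close>
    by (intro continuous_on_powr' continuous_intros) (auto simp: infdist_nonneg)
  then have f_cont: "isCont f s" for s
    by (simp add: continuous_on_eq_continuous_at)
  \<comment> \<open>Off \<open>B\<close> the order of the bodies is locally constant: strict
    inequalities persist by continuity, and two equal projections must be equal at all
    times.\<close>
  have w_const: "\<forall>\<^sub>F r in nhds s. w r = w s" if s: "s \<in> {0..T}" "s \<notin> B" for s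
  proof -
    have l_tendsto: "((\<lambda>r. l r j - l r i) \<longlongrightarrow> l s j - l s i) (nhds s)" for i j
      unfolding l_def by (intro tendsto_intros filterlim_ident) (use \<open>0 < T\<close> in auto)
    have "\<forall>\<^sub>F r in nhds s. l r i < l r j \<longleftrightarrow> l s i < l s j" for i j
    proof -
      consider "l s i < l s j" | "l s j < l s i" | "l s i = l s j" by linarith
      then show ?thesis
      proof cases
        case 1
        then have "\<forall>\<^sub>F r in nhds s. l r j - l r i > 0"
          using l_tendsto[where i = i and j = j] by (intro order_tendstoD(1)) auto
        then show ?thesis by eventually_elim (use 1 in auto)
      next
        case 2
        then have "\<forall>\<^sub>F r in nhds s. l r j - l r i < 0"
          using l_tendsto[where i = i and j = j] by (intro order_tendstoD(2)) auto
        then show ?thesis by eventually_elim (use 2 in auto)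
      next
        case 3
        \<comment> \<open>The projections agree at \<open>s\<close>. If \<open>p\<close> and
          \<open>q\<close> differed, \<open>s\<close> would be a crossing time and so lie in
          \<open>B\<close>. Hence \<open>p = q\<close>, and both are 0 because the difference is
          constant in time.\<close>
        define p q where "p = (x $ i - x $ j) \<bullet> e" and "q = (y $ i - y $ j) \<bullet> e"
        have l_diff: "l r i - l r j = p + r / T * (q - p)" for r
          by (simp add: l_def p_def q_def inner_diff_left algebra_simps)
        have "s * (p - q) = T * p"
          using l_diff[of s] 3 \<open>0 < T\<close> by (simp add: field_simps)
        moreover have "p = q"
        proof (rule ccontr)
          assume "p \<noteq> q"
          with \<open>s * (p - q) = T * p\<close> have "s = T * p / (p - q)"
            by (simp add: field_simps)
          also have "\<dots> = crossing (i, j)"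
            by (simp add: crossing_def p_def q_def)
          finally show False using s by (auto simp: B_def)
        qed
        ultimately have "l r i = l r j" for r
          using l_diff[of r] \<open>0 < T\<close> by simp
        then show ?thesis by simp
      qed
    qed
    then have "\<forall>\<^sub>F r in nhds s. \<forall>i j. l r i < l r j \<longleftrightarrow> l s i < l s j"
      by (intro eventually_all_finite)
    then show ?thesis
    proof eventually_elim
      case (elim r)
      then have "l r i = l r j \<longleftrightarrow> l s i = l s j" for i j
        by (metis linorder_less_linear order_less_irrefl)
      with elim show ?case by (simp add: w_def rank_def)
    qed
  qed
  have w_bounded: "norm (w s) \<le> CARD('n) * CARD('n)" for s
  proof -
    have "norm (w s) \<le> (\<Sum>i\<in>UNIV. norm (w s $ i))"
      unfolding norm_vec_def by (intro L2_set_le_sum) auto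
    also have "\<dots> \<le> (\<Sum>i\<in>(UNIV :: 'n set). real CARD('n))"
      by (intro sum_mono) (use e in \<open>simp add: w_def rank_nonneg rank_le\<close>)
    finally show ?thesis by simp
  qed
  \<comment> \<open>At times in \<open>B\<close> the ranks may jump, but they are bounded and the
    factor \<open>f\<close> tends to 0.\<close>
  have fw_cont: "isCont (\<lambda>s. f s *\<^sub>R w s) s" if s: "s \<in> {0..T}" for s
  proof (cases "s \<in> B")
    case True
    have "((\<lambda>r. f r * (CARD('n) * CARD('n))) \<longlongrightarrow> f s * (CARD('n) * CARD('n))) (at s)"
      using f_cont[of s] unfolding isCont_def by (intro tendsto_intros)
    then have "((\<lambda>r. f r * (CARD('n) * CARD('n))) \<longlongrightarrow> 0) (at s)"
      using f_B[OF True] by simp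
    moreover have "\<forall>\<^sub>F r in at s. norm (f r *\<^sub>R w r) \<le> f r * (CARD('n) * CARD('n))"
      using mult_left_mono[OF w_bounded f_nonneg] f_nonneg by (intro always_eventually) simp
    ultimately have "((\<lambda>r. f r *\<^sub>R w r) \<longlongrightarrow> 0) (at s)"
      by (rule Lim_null_comparison[rotated])
    then show ?thesis by (simp add: isCont_def f_B[OF True])
  next
    case False
    have "\<forall>\<^sub>F r in nhds s. f r *\<^sub>R w r = f r *\<^sub>R w s"
      using w_const[OF s False] by eventually_elim simp
    moreover have "isCont (\<lambda>r. f r *\<^sub>R w s) s"
      by (intro continuous_intros f_cont)
    ultimately show ?thesis
      using isCont_cong[of "\<lambda>r. f r *\<^sub>R w r" "\<lambda>r. f r *\<^sub>R w s" s] by blast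
  qed
  show thesis
  proof
    show "finite B" "B \<subseteq> {0..T}" "card B \<le> (CARD('n))\<^sup>2 + 2" "finite S" "B \<subseteq> S"
      using B card_B by (auto simp: S_def)
    show "B \<noteq> {}" using B by blast
    show "\<gamma> 0 = x" "\<gamma> T = y"
      using f_B B \<open>0 < T\<close> by (auto simp: \<gamma>_def)
    show "continuous_on {0..T} \<gamma>"
      unfolding \<gamma>_def
      by (intro continuous_on_add continuous_intros continuous_at_imp_continuous_on ballI fw_cont)
        (use \<open>0 < T\<close> in auto)
  next
    fix s assume s: "s \<in> {0..T} - S"
    then have "s \<in> {0..T}" "s \<notin> B" "s \<notin> (\<lambda>(t, t'). (t + t') / 2) ` (B \<times> B)"
      by (auto simp: S_def)
    then obtain f' where f': "(f has_real_derivative f') (at s)"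
      "\<bar>f'\<bar> = \<bar>a\<bar> * infdist s B powr (a - 1)"
      using infdist_powr_derivative[of B s a] B unfolding f_def by blast
    \<comment> \<open>Near \<open>s\<close> the ranks can be frozen at their value at
      \<open>s\<close>, so only the segment and \<open>f\<close> are differentiated.\<close>
    have "((\<lambda>r. x + (r / T) *\<^sub>R (y - x) + f r *\<^sub>R w s) has_vector_derivative
        (1 / T) *\<^sub>R (y - x) + f' *\<^sub>R w s) (at s)"
      using \<open>0 < T\<close> by (auto intro!: derivative_eq_intros f'(1))
    moreover have "\<forall>\<^sub>F r in nhds s. \<gamma> r = x + (r / T) *\<^sub>R (y - x) + f r *\<^sub>R w s"
      using w_const[OF \<open>s \<in> {0..T}\<close> \<open>s \<notin> B\<close>] by eventually_elim (simp add: \<gamma>_def)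
    ultimately have "(\<gamma> has_vector_derivative (1 / T) *\<^sub>R (y - x) + f' *\<^sub>R w s) (at s)"
      by (subst has_vector_derivative_cong_ev[where g = "\<lambda>r. x + (r / T) *\<^sub>R (y - x) + f r *\<^sub>R w s"])
        (auto elim: eventually_mono dest: eventually_nhds_x_imp_x)
    moreover have "norm (((1 / T) *\<^sub>R (y - x) + f' *\<^sub>R w s) $ i) \<le>
        norm ((x - y) $ i) / T + a * CARD('n) * infdist s B powr (a - 1)" for i
    proof -
      have "norm (((1 / T) *\<^sub>R (y - x) + f' *\<^sub>R w s) $ i) \<le>
          norm ((1 / T) *\<^sub>R (y - x) $ i) + norm ((f' *\<^sub>R w s) $ i)"
        by (simp only: vector_add_component vector_scaleR_component norm_triangle_ineq)
      also have "norm ((1 / T) *\<^sub>R (y - x) $ i) = norm ((x - y) $ i) / T"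
        using \<open>0 < T\<close> by (simp add: norm_minus_commute)
      also have "norm ((f' *\<^sub>R w s) $ i) \<le> \<bar>f'\<bar> * CARD('n)"
        using e rank_le[of "l s" i] by (simp add: w_def rank_nonneg abs_mult mult_left_mono)
      finally show ?thesis
        using f'(2) \<open>0 < a\<close> by (simp add: mult_ac)
    qed
    ultimately show "\<exists>d. (\<gamma> has_vector_derivative d) (at s) \<and>
      (\<forall>i. norm (d $ i) \<le> norm ((x - y) $ i) / T + a * CARD('n) * infdist s B powr (a - 1))"
      by blast
  next
    fix s and i j :: 'n
    assume "i \<noteq> j"
    \<comment> \<open>Seen along \<open>e\<close>, the bodies are shifted exactly as in
      \<open>rank_separates\<close>, and a distance in \<open>E\<close> is at least the distance of
      the projections.\<close>
    have proj: "\<gamma> s $ k \<bullet> e = l s k + f s * rank (l s) k" for k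
      using e by (simp add: \<gamma>_def l_def w_def inner_add_left)
    have "f s \<le> \<bar>(\<gamma> s $ i - \<gamma> s $ j) \<bullet> e\<bar>"
      using rank_separates[OF \<open>i \<noteq> j\<close> f_nonneg, of s "l s"] by (simp add: inner_diff_left proj)
    also have "\<dots> \<le> norm (\<gamma> s $ i - \<gamma> s $ j)"
      using Basis_le_norm[OF e] .
    finally show "infdist s B powr a \<le> norm (\<gamma> s $ i - \<gamma> s $ j)"
      by (simp add: f_def)
  qed
qed

section \<open>Estimate of the action of the spreading curve\<close>

lemma action_potential_le:
  fixes m :: "'n::{finite,linorder} \<Rightarrow> real" and \<kappa> :: real
  assumes m: "\<And>i. m i > 0" and \<kappa>: "0 < \<kappa>" "\<kappa> < 1"
  obtains K where "K > 0"
    "\<And>(x :: 'e::euclidean_space ^ 'n::{finite,linorder}) y r. 0 < r \<Longrightarrow> max_norm (x - y) \<le> r \<Longrightarrow>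
      action_potential m \<kappa> x y \<le> ennreal (K * r powr (1 - \<kappa>))"
proof -
  \<comment> \<open>The exponent for which \<open>(s\<^sup>a)'\<^sup>2\<close> and \<open>(s\<^sup>a) powr (- 2 * \<kappa>)\<close> have the same, integrable, order
    \<open>s powr (- \<beta>)\<close>.\<close>
  define a where "a = 1 / (1 + \<kappa>)"
  define \<beta> where "\<beta> = 2 * \<kappa> / (1 + \<kappa>)"
  define M where "M = (\<Sum>i\<in>UNIV. m i)"
  define W where "W = (\<Sum>(i, j)\<in>{(i, j). i < j}. m i * m j)"
  define N where "N = real CARD('n)"
  \<comment> \<open>There are at most \<open>N\<^sup>2 + 2\<close> singular times, and each
    contributes at most \<open>2 / (1 - \<beta>) * T powr (1 - \<beta>)\<close> to the integral of
    the singular terms.\<close>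
  define C where "C = (N\<^sup>2 + 2) * (2 / (1 - \<beta>))"
  define K where "K = M * (2 + 2 * (a * N)\<^sup>2 * C) + W * C"
  have a: "0 < a" and a_\<beta>: "2 * (a - 1) = - \<beta>" "a * (- 2 * \<kappa>) = - \<beta>"
    using \<kappa> by (auto simp: a_def \<beta>_def field_simps)
  have \<beta>: "\<beta> < 1" "(1 + \<kappa>) * (1 - \<beta>) = 1 - \<kappa>"
    using \<kappa> by (auto simp: \<beta>_def field_simps)
  have M: "M > 0"
    unfolding M_def using m by (intro sum_pos) auto
  have W: "W \<ge> 0"
    unfolding W_def using m by (intro sum_nonneg) (auto intro: less_imp_le)
  have C: "C > 0"
    using \<beta> by (simp add: C_def add_nonneg_pos)
  have "K > 0"
    unfolding K_def using M W C by (intro add_pos_nonneg mult_pos_pos) auto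
  moreover have "action_potential m \<kappa> x y \<le> ennreal (K * r powr (1 - \<kappa>))"
    if r: "0 < r" "max_norm (x - y) \<le> r" for x y :: "'e ^ 'n::{finite,linorder}" and r
  proof -
    define T where "T = r powr (1 + \<kappa>)"
    have T: "T > 0" using r by (simp add: T_def)
    \<comment> \<open>For this \<open>T\<close> both scales in the estimate,
      \<open>T powr (1 - \<beta>)\<close> from the singular terms and \<open>r\<^sup>2 / T\<close>
      from the straight motion, equal \<open>r powr (1 - \<kappa>)\<close>.\<close>
    have T_\<beta>: "T powr (1 - \<beta>) = r powr (1 - \<kappa>)"
      by (simp add: T_def powr_powr \<beta>(2))
    have r_T: "r\<^sup>2 / T = r powr (1 - \<kappa>)"
    proof -
      have "r\<^sup>2 / T = r powr 2 / r powr (1 + \<kappa>)"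
        using r by (simp add: T_def)
      also have "\<dots> = r powr (1 - \<kappa>)"
        by (simp only: powr_diff[symmetric]) simp
      finally show ?thesis .
    qed
    obtain \<gamma> B S where B: "finite B" "B \<noteq> {}" "B \<subseteq> {0..T}" "card B \<le> (CARD('n))\<^sup>2 + 2"
      and ends: "\<gamma> 0 = x" "\<gamma> T = y" and cont: "continuous_on {0..T} \<gamma>"
      and S: "finite S" "B \<subseteq> S"
      and deriv: "\<And>s. s \<in> {0..T} - S \<Longrightarrow> \<exists>d. (\<gamma> has_vector_derivative d) (at s) \<and>
        (\<forall>i. norm (d $ i) \<le> norm ((x - y) $ i) / T + a * CARD('n) * infdist s B powr (a - 1))"
      and sep: "\<And>s i j. s \<in> {0..T} \<Longrightarrow> i \<noteq> j \<Longrightarrow>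
        infdist s B powr a \<le> norm (\<gamma> s $ i - \<gamma> s $ j)"
      by (rule spreading_curve[OF a T, of x y]) (rule that)
    \<comment> \<open>\<open>D\<close> dominates \<open>infdist s B powr (- \<beta>)\<close>. Then
      \<open>P\<close> bounds the squared speed of each single body, through
      \<open>(u + v)\<^sup>2 \<le> 2 * u\<^sup>2 + 2 * v\<^sup>2\<close>.\<close>
    define D where "D s = (\<Sum>t\<in>B. \<bar>s - t\<bar> powr (- \<beta>))" for s
    define P where "P s = 2 * (r / T)\<^sup>2 + 2 * (a * N)\<^sup>2 * D s" for s
    have D: "0 \<le> D s" for s
      unfolding D_def by (intro sum_nonneg) auto
    have P: "0 \<le> P s" for s
      using D by (simp add: P_def)
    have "\<exists>I. (D has_integral I) {0..T} \<and> I \<le> C * T powr (1 - \<beta>)"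
    proof (intro exI conjI)
      show "(D has_integral (\<Sum>t\<in>B. (t powr (1 - \<beta>) + (T - t) powr (1 - \<beta>)) / (1 - \<beta>))) {0..T}"
        unfolding D_def using B \<beta> by (intro has_integral_sum has_integral_abs_diff_powr) auto
      have "(t powr (1 - \<beta>) + (T - t) powr (1 - \<beta>)) / (1 - \<beta>) \<le> 2 / (1 - \<beta>) * T powr (1 - \<beta>)"
        if "t \<in> B" for t
      proof -
        have "t powr (1 - \<beta>) \<le> T powr (1 - \<beta>)" "(T - t) powr (1 - \<beta>) \<le> T powr (1 - \<beta>)"
          using that B(3) \<beta> by (auto intro!: powr_mono2)
        then have "(t powr (1 - \<beta>) + (T - t) powr (1 - \<beta>)) / (1 - \<beta>) \<le>
            (2 * T powr (1 - \<beta>)) / (1 - \<beta>)"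
          using \<beta> by (intro divide_right_mono) auto
        then show ?thesis by simp
      qed
      then have "(\<Sum>t\<in>B. (t powr (1 - \<beta>) + (T - t) powr (1 - \<beta>)) / (1 - \<beta>)) \<le>
          card B * (2 / (1 - \<beta>) * T powr (1 - \<beta>))"
        by (rule sum_bounded_above)
      also have "\<dots> \<le> (N\<^sup>2 + 2) * (2 / (1 - \<beta>) * T powr (1 - \<beta>))"
      proof (rule mult_right_mono)
        show "real (card B) \<le> N\<^sup>2 + 2"
          using of_nat_mono[OF B(4), where 'a = real] by (simp add: N_def)
      qed (use \<beta> in simp)
      finally show "(\<Sum>t\<in>B. (t powr (1 - \<beta>) + (T - t) powr (1 - \<beta>)) / (1 - \<beta>)) \<le>
          C * T powr (1 - \<beta>)"
        unfolding C_def mult.assoc .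
    qed
    then obtain I where I: "(D has_integral I) {0..T}" "I \<le> C * r powr (1 - \<kappa>)"
      unfolding T_\<beta> by blast
    have P_int: "(P has_integral 2 * r powr (1 - \<kappa>) + 2 * (a * N)\<^sup>2 * I) {0..T}"
    proof -
      have "((\<lambda>s. 2 * (r / T)\<^sup>2) has_integral T *\<^sub>R (2 * (r / T)\<^sup>2)) {0..T}"
        using has_integral_const_real[of "2 * (r / T)\<^sup>2" 0 T] T by simp
      moreover have "T *\<^sub>R (2 * (r / T)\<^sup>2) = 2 * r powr (1 - \<kappa>)"
        using T by (simp flip: r_T add: field_simps power2_eq_square)
      ultimately have "((\<lambda>s. 2 * (r / T)\<^sup>2) has_integral 2 * r powr (1 - \<kappa>)) {0..T}"
        by (simp only:)
      from has_integral_add[OF this has_integral_mult_right[OF I(1)]] show ?thesis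
        unfolding P_def .
    qed
    have deriv': "\<exists>d. (\<gamma> has_vector_derivative d) (at s) \<and> (\<forall>i. (norm (d $ i))\<^sup>2 \<le> P s)"
      if s: "s \<in> {0..T} - S" for s
    proof -
      obtain d where d: "(\<gamma> has_vector_derivative d) (at s)"
        "\<And>i. norm (d $ i) \<le> norm ((x - y) $ i) / T + a * N * infdist s B powr (a - 1)"
        using deriv[OF s] unfolding N_def by blast
      have "(norm (d $ i))\<^sup>2 \<le> P s" for i
      proof -
        let ?g = "infdist s B powr (a - 1)"
        have "norm ((x - y) $ i) \<le> max_norm (x - y)"
          unfolding max_norm_def by (intro Max_ge) auto
        then have "norm ((x - y) $ i) / T \<le> r / T"
          using r T by (simp add: divide_right_mono)
        with d(2)[of i] have "norm (d $ i) \<le> r / T + a * N * ?g" by simp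
        then have "(norm (d $ i))\<^sup>2 \<le> (r / T + a * N * ?g)\<^sup>2"
          by (intro power_mono) auto
        also have "\<dots> \<le> 2 * (r / T)\<^sup>2 + 2 * (a * N * ?g)\<^sup>2"
          using sum_squares_bound[of "r / T" "a * N * ?g"] by (simp add: power2_sum)
        also have "(a * N * ?g)\<^sup>2 = (a * N)\<^sup>2 * infdist s B powr (- \<beta>)"
          by (simp only: power_mult_distrib[of "a * N"] power2_eq_square[of ?g] powr_add[symmetric]
            mult_2[symmetric] a_\<beta>(1))
        also have "infdist s B powr (- \<beta>) \<le> D s"
          unfolding D_def using B by (intro infdist_powr_le_sum)
        finally show ?thesis by (simp add: P_def mult_left_mono)
      qed
      with d(1) show ?thesis by blast
    qed
    have "absolutely_continuous_curve 0 T \<gamma>"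
    proof (rule absolutely_continuous_curve_of_square_integrable_derivative[OF S(1) cont])
      \<comment> \<open>The product norm adds up the squared speeds of all \<open>N\<close> bodies,
        hence the factor \<open>N\<close>.\<close>
      show "(\<lambda>s. N * P s) integrable_on {0..T}"
        using has_integral_mult_right[OF P_int] by (rule has_integral_integrable)
      fix s assume "s \<in> {0<..<T} - S"
      then obtain d where d: "(\<gamma> has_vector_derivative d) (at s)" "\<And>i. (norm (d $ i))\<^sup>2 \<le> P s"
        using deriv'[of s] by auto
      have "(norm d)\<^sup>2 = (\<Sum>i\<in>UNIV. (norm (d $ i))\<^sup>2)"
        by (simp add: norm_vec_def L2_set_def sum_nonneg)
      also have "\<dots> \<le> (\<Sum>i\<in>(UNIV :: 'n set). P s)"
        using d(2) by (intro sum_mono)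
      finally show "\<exists>d. (\<gamma> has_vector_derivative d) (at s) \<and> (norm d)\<^sup>2 \<le> N * P s"
        using d(1) by (auto simp: N_def)
    qed (use P in \<open>simp add: N_def\<close>)
    with ends have curve: "\<gamma> \<in> curves x y T"
      by (simp add: curves_def)
    have kinetic: "(\<integral>\<^sup>+ s\<in>{0..T}. ennreal (mass_norm_sq m (vector_derivative \<gamma> (at s within {0..T})))
        \<partial>lebesgue) \<le> ennreal (M * (2 * r powr (1 - \<kappa>) + 2 * (a * N)\<^sup>2 * I))"
    proof (rule set_nn_integral_le_has_integral[OF S(1)])
      show "((\<lambda>s. M * P s) has_integral M * (2 * r powr (1 - \<kappa>) + 2 * (a * N)\<^sup>2 * I)) {0..T}"
        using P_int by (rule has_integral_mult_right)
      fix s assume s: "s \<in> {0..T} - S"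
      then obtain d where d: "(\<gamma> has_vector_derivative d) (at s)" "\<And>i. (norm (d $ i))\<^sup>2 \<le> P s"
        using deriv'[of s] by auto
      have "vector_derivative \<gamma> (at s within {0..T}) = d"
        using vector_derivative_at_within_ivl[OF d(1)] s T by simp
      moreover have "mass_norm_sq m d \<le> (\<Sum>i\<in>UNIV. m i * P s)"
        unfolding mass_norm_sq_def using d(2) m by (intro sum_mono mult_left_mono) (auto intro: less_imp_le)
      ultimately show "ennreal (mass_norm_sq m (vector_derivative \<gamma> (at s within {0..T})))
          \<le> ennreal (M * P s)"
        by (simp add: M_def sum_distrib_right ennreal_leI)
    qed (use P M in simp)
    have pot: "(\<integral>\<^sup>+ s\<in>{0..T}. potential m \<kappa> (\<gamma> s) \<partial>lebesgue) \<le> ennreal (W * I)"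
    proof (rule set_nn_integral_le_has_integral[OF S(1)])
      show "((\<lambda>s. W * D s) has_integral W * I) {0..T}"
        using I(1) by (rule has_integral_mult_right)
      fix s assume s: "s \<in> {0..T} - S"
      \<comment> \<open>Off \<open>S\<close> the separation is strictly positive, so there is no
        collision and the potential takes its finite branch.\<close>
      then have "infdist s B > 0"
        using S B by (intro infdist_pos_not_in_closed finite_imp_closed) auto
      have sep_s: "0 < infdist s B powr a" "infdist s B powr a \<le> norm (\<gamma> s $ i - \<gamma> s $ j)"
        if "i \<noteq> j" for i j
        using sep[of s i j] s that \<open>infdist s B > 0\<close> by auto
      have no_collision: "\<not> (\<exists>i j. i \<noteq> j \<and> \<gamma> s $ i = \<gamma> s $ j)"
        using sep_s by fastforce
      have "norm (\<gamma> s $ i - \<gamma> s $ j) powr (- 2 * \<kappa>) \<le> D s" if "i < j" for i j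
      proof -
        have "norm (\<gamma> s $ i - \<gamma> s $ j) powr (- 2 * \<kappa>) \<le> (infdist s B powr a) powr (- 2 * \<kappa>)"
          using \<kappa> sep_s[of i j] that by (intro powr_mono2') auto
        also have "\<dots> = infdist s B powr (- \<beta>)"
          by (simp only: powr_powr a_\<beta>(2))
        also have "\<dots> \<le> D s"
          unfolding D_def using B by (intro infdist_powr_le_sum)
        finally show ?thesis .
      qed
      then have "(\<Sum>(i, j)\<in>{(i, j). i < j}. m i * m j * norm (\<gamma> s $ i - \<gamma> s $ j) powr (- 2 * \<kappa>))
          \<le> (\<Sum>(i, j)\<in>{(i, j). i < j}. m i * m j * D s)"
        using m by (intro sum_mono) (auto intro!: mult_left_mono intro: less_imp_le)
      also have "\<dots> = W * D s"
        by (simp add: W_def sum_distrib_right case_prod_unfold)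
      finally show "potential m \<kappa> (\<gamma> s) \<le> ennreal (W * D s)"
        unfolding potential_def if_not_P[OF no_collision] by (rule ennreal_leI)
    qed (use D W in simp)
    have "I \<ge> 0"
      using has_integral_nonneg[OF I(1)] D by simp
    \<comment> \<open>The constant need not be sharp, so the factor 1/2 of the kinetic energy is
      dropped.\<close>
    have half: "1 / 2 * X \<le> X" for X :: ennreal
    proof -
      have "1 / 2 \<le> (1 :: ennreal)"
        by (simp add: divide_le_posI_ennreal)
      then show ?thesis using mult_right_mono[of "1 / 2" 1 X] by simp
    qed
    have "action_potential m \<kappa> x y \<le> fixed_time_action_potential m \<kappa> x y T"
      unfolding action_potential_def using T by (intro INF_lower) simp
    also have "\<dots> \<le> action m \<kappa> 0 T \<gamma>"
      unfolding fixed_time_action_potential_def using curve by (rule INF_lower)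
    also have "\<dots> \<le> ennreal (M * (2 * r powr (1 - \<kappa>) + 2 * (a * N)\<^sup>2 * I)) + ennreal (W * I)"
      unfolding action_def by (intro add_mono order_trans[OF half] kinetic pot)
    also have "\<dots> = ennreal (M * (2 * r powr (1 - \<kappa>) + 2 * (a * N)\<^sup>2 * I) + W * I)"
      using M W \<open>I \<ge> 0\<close> by (intro ennreal_plus[symmetric]) auto
    also have "\<dots> \<le> ennreal (M * (2 * r powr (1 - \<kappa>) + 2 * (a * N)\<^sup>2 * (C * r powr (1 - \<kappa>)))
        + W * (C * r powr (1 - \<kappa>)))"
      using I(2) M W by (intro ennreal_leI add_mono mult_left_mono) auto
    also have "M * (2 * r powr (1 - \<kappa>) + 2 * (a * N)\<^sup>2 * (C * r powr (1 - \<kappa>)))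
        + W * (C * r powr (1 - \<kappa>)) = K * r powr (1 - \<kappa>)"
      by (simp add: K_def algebra_simps)
    finally show ?thesis .
  qed
  ultimately show thesis by (rule that)
qed

section \<open>From positive radii to the distance itself, with distance 0 as a limit\<close>

theorem theorem2:
  fixes m :: "'n::{finite,linorder} \<Rightarrow> real" and \<kappa> :: real
  assumes "CARD('n) \<ge> 2"
    and "\<And>i. m i > 0"
    and "0 < \<kappa>" and "\<kappa> < 1"
  shows "\<exists>\<eta>::real. \<eta> > 0 \<and>
    (\<forall>x y :: 'e::euclidean_space ^ 'n::{finite,linorder}.
      action_potential m \<kappa> x y \<le> ennreal (\<eta> * max_norm (x - y) powr (1 - \<kappa>)))"
proof -
  obtain K where K: "K > 0"
    "\<And>(x :: 'e ^ 'n::{finite,linorder}) y r. 0 < r \<Longrightarrow> max_norm (x - y) \<le> r \<Longrightarrow>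
      action_potential m \<kappa> x y \<le> ennreal (K * r powr (1 - \<kappa>))"
    using action_potential_le[of m \<kappa>] assms(2-4) by blast
  have "action_potential m \<kappa> x y \<le> ennreal (K * max_norm (x - y) powr (1 - \<kappa>))"
    for x y :: "'e ^ 'n::{finite,linorder}"
  proof (cases "max_norm (x - y) > 0")
    case True
    show ?thesis using K(2)[OF True order_refl] .
  next
    case False
    \<comment> \<open>Even for \<open>x = y\<close> the curve must leave a collision configuration, in arbitrarily short time.\<close>
    have "0 \<le> norm ((x - y) $ undefined)" by simp
    also have "\<dots> \<le> max_norm (x - y)"
      unfolding max_norm_def by (intro Max_ge) auto
    finally have 0: "max_norm (x - y) = 0" using False by simp
    have "action_potential m \<kappa> x y \<le> 0"
    proof (rule ennreal_le_epsilon)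
      fix \<epsilon> :: real assume "0 < \<epsilon>"
      \<comment> \<open>The radius is the solution of
        \<open>K * r powr (1 - \<kappa>) = \<epsilon>\<close>.\<close>
      then have "action_potential m \<kappa> x y \<le>
          ennreal (K * ((\<epsilon> / K) powr (1 / (1 - \<kappa>))) powr (1 - \<kappa>))"
        using K(1) 0 by (intro K(2)) auto
      also have "K * ((\<epsilon> / K) powr (1 / (1 - \<kappa>))) powr (1 - \<kappa>) = \<epsilon>"
        using K(1) \<open>0 < \<epsilon>\<close> assms(4) by (simp add: powr_powr)
      finally show "action_potential m \<kappa> x y \<le> 0 + ennreal \<epsilon>" by simp
    qed
    then show ?thesis using 0 by simp
  qed
  with K(1) show ?thesis by blast
qed

end
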